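(* Let $\alpha$ be a set with an involution $\tau\colon\alpha\to\alpha$, and let $a,b$ be two distinct elements of $\alpha$. Consider words on $\alpha$ up to homotopy. Then: (1) The words $aaabb$, $aabba$, $abbaa$, $bbaaa$ are homotopic to each other; they are contractible if and only if $\tau(a)=a$. (2) The word $baaab$ is contractible if and only if $\tau(a)=a$. (3) The word $ababa$ is contractible if and only if $\tau(a)=b$. (4) The words $abaab$, $baaba$, $aabab$, $babaa$ are never contractible. (5) A non-contractible word from the lists in (2), (3), (4) is never homotopic to a word from the list in (1). (6) Two non-contractible words from the lists in (2), (3), (4) are homotopic to each other if and only if they coincide letterwise (i.e., if and only if they are the same word written twice), with the following exceptions: if $\tau(a)=b$, then $aabab\simeq babaa\simeq baaab$.
   Context: Fix a set $\alpha$ (the alphabet) with an involution $\tau\colon\alpha\to\alpha$. An $\alpha$-alphabet is a set $\mathcal{A}$ with a map $\mathcal{A}\to\alpha$, $A\mapsto|A|$. An étale word over $\alpha$ is a pair $(\mathcal{A},w)$, where $\mathcal{A}$ is an $\alpha$-alphabet and $w$ is a word (finite sequence) in letters of $\mathcal{A}$. A word on $\alpha$ is regarded as an étale word with $\mathcal{A}=\alpha$ and $|\cdot|=\mathrm{id}$. A nanoword over $\alpha$ is an étale word $(\mathcal{A},w)$ such that $\mathcal{A}$ is finite and every letter of $\mathcal{A}$ appears in $w$ exactly twice. Two étale words $(\mathcal{A}_1,w_1)$ and $(\mathcal{A}_2,w_2)$ are isomorphic if there is a bijection $f\colon\mathcal{A}_1\to\mathcal{A}_2$ with $|f(A)|=|A|$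 for all $A$ that sends $w_1$ letterwise to $w_2$. Homotopy of nanowords (denoted $\simeq$) is the equivalence relation generated by isomorphisms and the following three moves and their inverses: (i) $(\mathcal{A},xAAy)\mapsto(\mathcal{A}-\{A\},xy)$, where $x,y$ are words on $\mathcal{A}-\{A\}$; (ii) $(\mathcal{A},xAByBAz)\mapsto(\mathcal{A}-\{A,B\},xyz)$ if $|A|=\tau(|B|)$, where $x,y,z$ are words on $\mathcal{A}-\{A,B\}$; (iii) $(\mathcal{A},xAByACzBCt)\mapsto(\mathcal{A},xBAyCAzCBt)$ if $|A|=|B|=|C|$, where $x,y,z,t$ are words on $\mathcal{A}-\{A,B,C\}$. Here $A$, $B$, $C$ are distinct letters of $\mathcal{A}$. Desingularization: for an étale word $(\mathcal{A},w)$, let $m_w(A)$ be the number of occurrences of $A$ in $w$. Set $\mathcal{A}^d=\{A_{i,j}: A\in\mathcal{A},\ 1\le i<j\le m_w(A)\}$ with $|A_{i,j}|=|A|$. The word $w^d$ on $\mathcal{A}^d$ is obtained from $w$ by deleting all letters of multiplicity $1$ and, for each $A$ with $m=m_w(A)\ge2$ and each $i=1,\dots,m$, replacing the $i$-th occurrence of $A$ in $w$ by $A_{1,i}A_{2,i}\cdots A_{i-1,i}A_{i,i+1}A_{i,i+2}\cdots A_{i,m}$. Then $(\mathcal{A}^d,w^d)$ is a nanoword. Two étale words (in particular, two words on $\alpha$) $w_1,w_2$ are homotopic, $w_1\simeq w_2$, if $w_1^d\simeq w_2^d$. A word is contractible if it is homotopic to the empty nanoword. *)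

theory Defs
  imports Main
begin

text \<open>
  The set \<open>\<alpha>\<close> is the type \<^typ>\<open>'a\<close>. The involution \<open>\<tau>\<close> on it is an explicit
  parameter \<open>tau\<close>.
\<close>

text \<open>Only the values of \<open>proj\<close> on \<open>alphabet\<close> are meaningful.\<close>

record ('l, 'a) etale =
  alphabet :: "'l set"
  proj :: "'l \<Rightarrow> 'a"
  letters :: "'l list"

definition etale_word :: "('l, 'a) etale \<Rightarrow> bool" where
  "etale_word W \<longleftrightarrow> set (letters W) \<subseteq> alphabet W"

definition nanoword :: "('l, 'a) etale \<Rightarrow> bool" where
  "nanoword W \<longleftrightarrow> etale_word W \<and> finite (alphabet W) \<and>
     (\<forall>A\<in>alphabet W. count_list (letters W) A = 2)"

definition isomorphic :: "('l, 'a) etale \<Rightarrow> ('k, 'a) etale \<Rightarrow> bool" where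
  "isomorphic W V \<longleftrightarrow> (\<exists>f. bij_betw f (alphabet W) (alphabet V) \<and>
     (\<forall>A\<in>alphabet W. proj V (f A) = proj W A) \<and> map f (letters W) = letters V)"

inductive nanoword_step :: "('a \<Rightarrow> 'a) \<Rightarrow> ('l, 'a) etale \<Rightarrow> ('l, 'a) etale \<Rightarrow> bool"
  for tau :: "'a \<Rightarrow> 'a"
where
  iso: "nanoword W \<Longrightarrow> nanoword V \<Longrightarrow> isomorphic W V \<Longrightarrow> nanoword_step tau W V"
| move1: "nanoword \<lparr>alphabet = \<A>, proj = p, letters = x @ [A, A] @ y\<rparr> \<Longrightarrow>
    set x \<union> set y \<subseteq> \<A> - {A} \<Longrightarrow>
    nanoword_step tau
      \<lparr>alphabet = \<A>, proj = p, letters = x @ [A, A] @ y\<rparr>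
      \<lparr>alphabet = \<A> - {A}, proj = p, letters = x @ y\<rparr>"
| move2: "nanoword \<lparr>alphabet = \<A>, proj = p, letters = x @ [A, B] @ y @ [B, A] @ z\<rparr> \<Longrightarrow>
    A \<noteq> B \<Longrightarrow> set x \<union> set y \<union> set z \<subseteq> \<A> - {A, B} \<Longrightarrow>
    p A = tau (p B) \<Longrightarrow>
    nanoword_step tau
      \<lparr>alphabet = \<A>, proj = p, letters = x @ [A, B] @ y @ [B, A] @ z\<rparr>
      \<lparr>alphabet = \<A> - {A, B}, proj = p, letters = x @ y @ z\<rparr>"
| move3: "nanoword \<lparr>alphabet = \<A>, proj = p,
      letters = x @ [A, B] @ y @ [A, C] @ z @ [B, C] @ t\<rparr> \<Longrightarrow>
    distinct [A, B, C] \<Longrightarrow> set x \<union> set y \<union> set z \<union> set t \<subseteq> \<A> - {A, B, C} \<Longrightarrow>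
    p A = p B \<Longrightarrow> p B = p C \<Longrightarrow>
    nanoword_step tau
      \<lparr>alphabet = \<A>, proj = p, letters = x @ [A, B] @ y @ [A, C] @ z @ [B, C] @ t\<rparr>
      \<lparr>alphabet = \<A>, proj = p, letters = x @ [B, A] @ y @ [C, A] @ z @ [C, B] @ t\<rparr>"

text \<open>
  Homotopy of nanowords is taken over one fixed type of letters, which should be infinite so that
  fresh letters are always available for the inverse moves. It is only used below at the letter
  type \<^typ>\<open>'l \<times> nat \<times> nat\<close> of desingularizations; since alphabets of nanowords are finite,
  any chain of moves using other letters can be renamed into this type.
\<close>

definition nanoword_homotopic :: "('a \<Rightarrow> 'a) \<Rightarrow> ('l, 'a) etale \<Rightarrow> ('l, 'a) etale \<Rightarrow> bool" where
  "nanoword_homotopic tau W V \<longleftrightarrow> nanoword W \<and> nanoword V \<and> equivclp (nanoword_step tau) W V"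

text \<open>
  The letter \<open>A\<^sub>i\<^sub>,\<^sub>j\<close> is the triple \<open>(A, i, j)\<close>. The \<open>i\<close>-th occurrence of a letter \<open>A\<close> of
  multiplicity \<open>m\<close> becomes \<open>desing_block A i m\<close>, which is empty when \<open>m = 1\<close>.
\<close>

definition desing_block :: "'l \<Rightarrow> nat \<Rightarrow> nat \<Rightarrow> ('l \<times> nat \<times> nat) list" where
  "desing_block A i m = map (\<lambda>r. (A, r, i)) [1..<i] @ map (\<lambda>s. (A, i, s)) [i + 1..<m + 1]"

definition desing_letters :: "'l list \<Rightarrow> ('l \<times> nat \<times> nat) list" where
  "desing_letters w = concat (map
     (\<lambda>k. desing_block (w ! k) (count_list (take (k + 1) w) (w ! k)) (count_list w (w ! k)))
     [0..<length w])"

definition desingularization :: "('l, 'a) etale \<Rightarrow> ('l \<times> nat \<times> nat, 'a) etale" where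
  "desingularization W =
     \<lparr>alphabet = {(A, i, j). A \<in> alphabet W \<and> 1 \<le> i \<and> i < j \<and> j \<le> count_list (letters W) A},
      proj = (\<lambda>(A, i, j). proj W A),
      letters = desing_letters (letters W)\<rparr>"

definition etale_homotopic :: "('a \<Rightarrow> 'a) \<Rightarrow> ('l, 'a) etale \<Rightarrow> ('l, 'a) etale \<Rightarrow> bool" where
  "etale_homotopic tau W V \<longleftrightarrow>
     nanoword_homotopic tau (desingularization W) (desingularization V)"

definition empty_nanoword :: "('l, 'a) etale" where
  "empty_nanoword = \<lparr>alphabet = {}, proj = (\<lambda>_. undefined), letters = []\<rparr>"

definition word :: "'a list \<Rightarrow> ('a, 'a) etale" where
  "word w = \<lparr>alphabet = UNIV, proj = id, letters = w\<rparr>"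

definition word_homotopic :: "('a \<Rightarrow> 'a) \<Rightarrow> 'a list \<Rightarrow> 'a list \<Rightarrow> bool" where
  "word_homotopic tau v w \<longleftrightarrow> etale_homotopic tau (word v) (word w)"

definition contractible_word :: "('a \<Rightarrow> 'a) \<Rightarrow> 'a list \<Rightarrow> bool" where
  "contractible_word tau w \<longleftrightarrow> etale_homotopic tau (word w) empty_nanoword"

end

theory Submission
  imports Defs Complex_Main
begin

text \<open>
  The homotopies of the theorem are short chains of moves. Besides the three moves themselves they
  use that a parallel pair \<open>A B \<dots> A B\<close> with \<open>\<bar>A\<bar> = \<tau>(\<bar>B\<bar>)\<close> can be deleted
  (\<open>homotopic_delete_parallel_pair\<close>). An adjacent \<open>b b\<close> cancels, so \<open>aaabb\<close>, \<open>aabba\<close>,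
  \<open>abbaa\<close>, \<open>bbaaa\<close> all become the triangle \<open>A B A C B C\<close> of three letters labelled \<open>a\<close>. If
  \<open>\<tau>(a) = a\<close>, the third move turns it into \<open>B A C A C B\<close>, and deleting the parallel pair \<open>A C\<close>
  leaves \<open>B B\<close>, which is contractible; then \<open>baaab\<close> contracts as well. If \<open>\<tau>(a) = b\<close>, then \<open>ababa\<close>
  contracts, and each of \<open>aabab\<close>, \<open>babaa\<close>, \<open>baaab\<close> reduces to \<open>X Y X Y\<close> with both letters
  labelled \<open>a\<close>.

  Everything else is separated by one kind of invariant. Read a nanoword from left to right
  carrying a colour. At the first occurrence of a letter labelled \<open>c\<close>, remember the current colour
  and apply a map \<open>f c\<close> to it; at the second occurrence apply a map \<open>s c\<close> that may depend on the
  remembered colour. The colour reached at the end, as a function of the initial one, is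
  unchanged by every move as soon as \<open>f\<close> and \<open>s\<close> satisfy one or two equations per move
  (locale \<open>alpha_kei\<close>, lemma \<open>final_colour_step\<close>); such structures are Turaev's \<open>\<alpha>\<close>-keis. Linear
  solutions over a field come from weights \<open>t\<close>, \<open>u\<close> on \<open>\<alpha>\<close> with
  \<open>t(\<tau>(c)) = 1 / t(c)\<close>, \<open>u(\<tau>(c)) = 1 / u(c)\<close> (lemma \<open>alexander_kei\<close>), and they turn a nanoword
  into a number.

  These numbers see the words in question. Write \<open>t\<close>, \<open>u\<close> for the weights of \<open>a\<close> and \<open>r = t u\<close>. The
  triangle labelled \<open>a\<close> has the value \<open>1 - r (1 - r) (1 - t) (1 - u)\<close>, which is not \<open>1\<close> for
  suitable weights unless \<open>\<tau>(a) = a\<close> forces both of them to be \<open>1\<close> or \<open>-1\<close>. Enclosing a nanoword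
  between two occurrences of a letter labelled \<open>\<tau>(a)\<close> divides the difference of its value from \<open>1\<close>
  by \<open>r\<close>; this is how \<open>baaab\<close> differs from \<open>aaabb\<close> even when \<open>\<tau>(a) = b\<close>. According to
  whether \<open>\<tau>(a)\<close> is \<open>a\<close>, \<open>b\<close> or another letter, one or two choices of rational weights then
  distinguish all the words that have to be distinguished.
\<close>

section \<open>Nanowords given by their letters\<close>

definition doubled :: "'l list \<Rightarrow> bool" where
  "doubled w \<longleftrightarrow> (\<forall>A. count_list w A = 0 \<or> count_list w A = 2)"

text \<open>
  In a nanoword every letter of the alphabet occurs, so the sequence of letters determines the
  alphabet.
\<close>

definition nano :: "('l \<Rightarrow> 'a) \<Rightarrow> 'l list \<Rightarrow> ('l, 'a) etale" where
  "nano p w = \<lparr>alphabet = set w, proj = p, letters = w\<rparr>"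

lemma nanoword_nano [simp]: "nanoword (nano p w) \<longleftrightarrow> doubled w"
  unfolding nanoword_def nano_def doubled_def etale_word_def
  by simp (metis count_list_0_iff zero_neq_numeral)

lemma nanoword_if_doubled:
  "doubled w \<Longrightarrow> nanoword \<lparr>alphabet = set w, proj = p, letters = w\<rparr>"
  by (simp flip: nano_def)

lemma doubled_iff_set: "doubled w \<longleftrightarrow> (\<forall>A\<in>set w. count_list w A = 2)"
  unfolding doubled_def by (metis count_list_0_iff zero_neq_numeral)

lemma doubled_cong:
  "(\<And>B. count_list v B = count_list w B) \<Longrightarrow> doubled v \<longleftrightarrow> doubled w"
  by (simp add: doubled_def)

text \<open>
  Multiplicities do not see the order of the letters. So this lemma and the next one decide
  whether a word stays doubled, and which letters are distinct, for all moves at once.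
\<close>

lemma doubled_add_letter:
  assumes "\<And>B. count_list v B = count_list w B + (if B = A then 2 else 0)"
  shows "doubled v \<longleftrightarrow> A \<notin> set w \<and> doubled w"
proof -
  have "doubled v \<longleftrightarrow> (\<forall>B. if B = A then count_list w B = 0 else count_list w B \<in> {0, 2})"
    unfolding doubled_def assms by auto
  also have "\<dots> \<longleftrightarrow> A \<notin> set w \<and> doubled w"
    unfolding doubled_def by (auto simp: count_list_0_iff)
  finally show ?thesis .
qed

lemma doubled_add_pair:
  assumes "\<And>C. count_list v C =
    count_list w C + (if C = A then 2 else 0) + (if C = B then 2 else 0)"
  shows "doubled v \<longleftrightarrow> A \<noteq> B \<and> A \<notin> set w \<and> B \<notin> set w \<and> doubled w"
proof -
  have "doubled v \<longleftrightarrow> B \<notin> set (A # A # w) \<and> doubled (A # A # w)"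
    by (rule doubled_add_letter) (simp add: assms)
  also have "doubled (A # A # w) \<longleftrightarrow> A \<notin> set w \<and> doubled w"
    by (rule doubled_add_letter) simp
  finally show ?thesis by auto
qed

section \<open>Homotopies\<close>

lemma nanoword_homotopic_trans [trans]:
  "nanoword_homotopic tau U V \<Longrightarrow> nanoword_homotopic tau V W \<Longrightarrow> nanoword_homotopic tau U W"
  unfolding nanoword_homotopic_def by (blast intro: equivclp_trans)

lemma nanoword_homotopic_sym:
  "nanoword_homotopic tau U V \<Longrightarrow> nanoword_homotopic tau V U"
  unfolding nanoword_homotopic_def by (blast intro: equivclp_sym)

lemma homotopic_step:
  assumes "nanoword_step tau W V" "nanoword W" "nanoword V"
  shows "nanoword_homotopic tau W V"
  using assms by (simp add: nanoword_homotopic_def r_into_equivclp)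

lemma homotopic_rename:
  assumes "doubled w" "inj_on g (set w)" "\<And>A. A \<in> set w \<Longrightarrow> q (g A) = p A"
  shows "nanoword_homotopic tau (nano p w) (nano q (map g w))"
proof (rule homotopic_step[OF nanoword_step.iso])
  have "count_list (map g w) (g A) = count_list w A" if "A \<in> set w" for A
    using that assms(2) by (intro count_list_inj_map) auto
  moreover have "B \<notin> set (map g w) \<or> (\<exists>A\<in>set w. B = g A)" for B by auto
  ultimately show *: "nanoword (nano q (map g w))"
    using assms(1) unfolding nanoword_nano doubled_def by (metis count_list_0_iff)
  show "nanoword (nano q (map g w))" by (rule *)
  show "isomorphic (nano p w) (nano q (map g w))"
    unfolding isomorphic_def using assms(2,3)
    by (intro exI[of _ g]) (simp add: nano_def bij_betw_def)
qed (use assms(1) in simp_all)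

text \<open>
  The labels of letters that do not occur can be chosen at will. This is what provides fresh
  letters with prescribed labels for the inverse moves.
\<close>

lemma homotopic_relabel:
  assumes "doubled w" "\<And>A. A \<in> set w \<Longrightarrow> q A = p A"
  shows "nanoword_homotopic tau (nano p w) (nano q w)"
  using homotopic_rename[of w id q p tau] assms by simp

lemma homotopic_rename_crossed_pair:
  assumes "A \<noteq> B" "C \<noteq> D" "p C = p A" "p D = p B"
  shows "nanoword_homotopic tau (nano p [A, B, A, B]) (nano p [C, D, C, D])"
proof -
  let ?g = "\<lambda>X. if X = A then C else D"
  have "nanoword_homotopic tau (nano p [A, B, A, B]) (nano p (map ?g [A, B, A, B]))"
    by (rule homotopic_rename) (use assms in \<open>auto simp: doubled_iff_set inj_on_def\<close>)
  then show ?thesis using assms by simp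
qed

lemma homotopic_delete_letter:
  assumes "doubled (x @ [A, A] @ y)"
  shows "nanoword_homotopic tau (nano p (x @ [A, A] @ y)) (nano p (x @ y))"
    (is "nanoword_homotopic _ (nano p ?v) (nano p ?w)")
proof (rule homotopic_step)
  have *: "A \<notin> set ?w" "doubled ?w"
    using assms doubled_add_letter[of ?v ?w A] by auto
  have "nanoword_step tau \<lparr>alphabet = set ?v, proj = p, letters = ?v\<rparr>
      \<lparr>alphabet = set ?v - {A}, proj = p, letters = ?w\<rparr>"
    by (rule nanoword_step.move1[OF nanoword_if_doubled[OF assms]]) (use * in auto)
  moreover have "set ?v - {A} = set ?w" using * by auto
  ultimately show "nanoword_step tau (nano p ?v) (nano p ?w)"
    by (simp only: nano_def)
  show "nanoword (nano p ?v)" "nanoword (nano p ?w)"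
    using assms * by simp_all
qed

lemma homotopic_delete_pair:
  assumes "doubled (x @ [A, B] @ y @ [B, A] @ z)" "p A = tau (p B)"
  shows "nanoword_homotopic tau (nano p (x @ [A, B] @ y @ [B, A] @ z)) (nano p (x @ y @ z))"
    (is "nanoword_homotopic _ (nano p ?v) (nano p ?w)")
proof (rule homotopic_step)
  have *: "A \<noteq> B" "A \<notin> set ?w" "B \<notin> set ?w" "doubled ?w"
    using assms(1) doubled_add_pair[of ?v ?w A B] by auto
  have "nanoword_step tau \<lparr>alphabet = set ?v, proj = p, letters = ?v\<rparr>
      \<lparr>alphabet = set ?v - {A, B}, proj = p, letters = ?w\<rparr>"
    by (rule nanoword_step.move2[OF nanoword_if_doubled[OF assms(1)]]) (use assms(2) * in auto)
  moreover have "set ?v - {A, B} = set ?w" using * by auto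
  ultimately show "nanoword_step tau (nano p ?v) (nano p ?w)"
    by (simp only: nano_def)
  show "nanoword (nano p ?v)" "nanoword (nano p ?w)"
    using assms * by simp_all
qed

lemma homotopic_triangle:
  assumes "doubled (x @ [A, B] @ y @ [A, C] @ z @ [B, C] @ t)" "p A = p B" "p B = p C"
  shows "nanoword_homotopic tau (nano p (x @ [A, B] @ y @ [A, C] @ z @ [B, C] @ t))
    (nano p (x @ [B, A] @ y @ [C, A] @ z @ [C, B] @ t))"
    (is "nanoword_homotopic _ (nano p ?v) (nano p ?w)")
proof (rule homotopic_step)
  have 1: "A \<noteq> B" "A \<notin> set (x @ y @ [C] @ z @ [C] @ t)" "B \<notin> set (x @ y @ [C] @ z @ [C] @ t)"
    using assms(1) doubled_add_pair[of ?v "x @ y @ [C] @ z @ [C] @ t" A B] by auto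
  have 2: "C \<notin> set (x @ [A, B] @ y @ [A] @ z @ [B] @ t)"
    using assms(1) doubled_add_letter[of ?v "x @ [A, B] @ y @ [A] @ z @ [B] @ t" C] by auto
  have "nanoword_step tau \<lparr>alphabet = set ?v, proj = p, letters = ?v\<rparr>
      \<lparr>alphabet = set ?v, proj = p, letters = ?w\<rparr>"
    by (rule nanoword_step.move3[OF nanoword_if_doubled[OF assms(1)]])
      (use assms(2,3) 1 2 in auto)
  moreover have "set ?v = set ?w" by auto
  ultimately show "nanoword_step tau (nano p ?v) (nano p ?w)"
    by (simp only: nano_def)
  show "nanoword (nano p ?v)" "nanoword (nano p ?w)"
    using assms(1) doubled_cong[of ?v ?w] by auto
qed

lemma fresh_letters:
  assumes "infinite (UNIV :: 'l set)" "finite (S :: 'l set)"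
  obtains P Q U V where "distinct [P, Q, U, V]" "P \<notin> S" "Q \<notin> S" "U \<notin> S" "V \<notin> S"
proof -
  have "infinite (- S)" using assms by (simp add: Compl_eq_Diff_UNIV)
  then obtain T where T: "T \<subseteq> - S" "finite T" "card T = 4"
    by (meson infinite_arbitrarily_large)
  obtain l where l: "set l = T" "distinct l" using T(2) finite_distinct_list by blast
  then have "length l = 4" using T(3) distinct_card by fastforce
  then obtain P Q U V where "l = [P, Q, U, V]"
    by (auto simp: numeral_eq_Suc length_Suc_conv)
  then show ?thesis using that[of P Q U V] l T(1) by auto
qed

text \<open>
  The second move deletes a pair of letters that returns in the opposite order. A pair that returns
  in the same order is deleted by inserting two cancelling pairs around it, in such a way that
  \<open>B\<close> and one letter of each inserted pair form a triangle with equal labels. After the third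
  move, all letters except those of \<open>x\<close>, \<open>y\<close>, \<open>z\<close> cancel.
\<close>

lemma homotopic_delete_parallel_pair:
  fixes p :: "'l \<Rightarrow> 'a"
  assumes inf: "infinite (UNIV :: 'l set)" and inv: "\<And>c. tau (tau c) = c"
    and d: "doubled (x @ [A, B] @ y @ [A, B] @ z)" and AB: "p A = tau (p B)"
  shows "nanoword_homotopic tau (nano p (x @ [A, B] @ y @ [A, B] @ z)) (nano p (x @ y @ z))"
proof -
  let ?w = "x @ [A, B] @ y @ [A, B] @ z"
  have AB': "A \<noteq> B" "A \<notin> set (x @ y @ z)" "B \<notin> set (x @ y @ z)" and d': "doubled (x @ y @ z)"
    using d doubled_add_pair[of ?w "x @ y @ z" A B] by auto
  obtain P Q U V where dist: "distinct [P, Q, U, V]"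
    and fresh: "P \<notin> set ?w" "Q \<notin> set ?w" "U \<notin> set ?w" "V \<notin> set ?w"
    by (rule fresh_letters[OF inf, of "set ?w"]) simp_all
  define q where "q = p(P := p A, U := p A, Q := p B, V := p B)"
  have q: "q P = p A" "q U = p A" "q Q = p B" "q V = p B" "q A = p A" "q B = p B"
    using dist fresh by (auto simp: q_def)
  have BA: "p B = tau (p A)" by (simp add: AB inv)
  have pq: "q C = p C" if "C \<in> set ?w" for C using that fresh by (auto simp: q_def)
  \<comment> \<open>The labels allow the pairs \<open>P Q\<close> and \<open>U V\<close> to be inserted, and \<open>V\<close>, \<open>Q\<close>, \<open>B\<close> carry the same
    label: \<open>V Q\<close>, \<open>B Q\<close>, \<open>B V\<close> in \<open>?w2\<close> are the corners of the triangle.\<close>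
  let ?w1 = "x @ [P, Q] @ ([A, B]) @ [Q, P] @ (y @ [A, B] @ z)"
  let ?w2 = "(x @ [P]) @ [U, V] @ ([Q, A, B, Q, P] @ y @ [A, B]) @ [V, U] @ z"
  let ?w3 = "(x @ [P, U]) @ [Q, V] @ [A] @ [Q, B] @ ([P] @ y @ [A]) @ [V, B] @ ([U] @ z)"
  let ?w4 = "(x @ [P, U, Q]) @ [Q, B] @ [P] @ y @ [B, U] @ z"
  have d1: "doubled ?w1"
    using doubled_add_pair[of ?w1 ?w P Q] d dist fresh by auto
  have d2: "doubled ?w2"
    using doubled_add_pair[of ?w2 ?w1 U V] d1 dist fresh by auto
  have d3: "doubled ?w3"
    using doubled_cong[of ?w3 ?w2] d2 by auto
  have d4: "doubled ?w4"
    using doubled_add_pair[of ?w3 ?w4 V A] d3 by auto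
  have d5: "doubled (x @ [P, U, B, P] @ y @ [B, U] @ z)"
    using doubled_add_letter[of ?w4 "x @ [P, U, B, P] @ y @ [B, U] @ z" Q] d4 by auto
  have d6: "doubled (x @ [P, P] @ y @ z)"
    using doubled_add_letter[of "x @ [P, P] @ y @ z" "x @ y @ z" P] d' fresh by auto
  have "nanoword_homotopic tau (nano p ?w) (nano q ?w)"
    by (rule homotopic_relabel[OF d pq])
  also have "nanoword_homotopic tau (nano q ?w) (nano q ?w1)"
    using homotopic_delete_pair[OF d1, of q tau] q AB
    by (auto intro: nanoword_homotopic_sym)
  also have "nanoword_homotopic tau (nano q ?w1) (nano q ?w2)"
    using homotopic_delete_pair[OF d2, of q tau] q AB
    by (auto intro: nanoword_homotopic_sym)
  also have "nanoword_homotopic tau (nano q ?w2) (nano q ?w3)"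
    using homotopic_triangle[OF d3, of q tau] q
    by (auto intro: nanoword_homotopic_sym)
  also have "nanoword_homotopic tau (nano q ?w3) (nano q ?w4)"
    using homotopic_delete_pair[of "x @ [P, U, Q]" V A "[Q, B, P] @ y" "[B, U] @ z" q tau] d3 q BA
    by auto
  also have "nanoword_homotopic tau (nano q ?w4) (nano q (x @ [P, U, B, P] @ y @ [B, U] @ z))"
    using homotopic_delete_letter[of "x @ [P, U]" Q "[B, P] @ y @ [B, U] @ z" tau q] d4
    by auto
  also have "nanoword_homotopic tau (nano q (x @ [P, U, B, P] @ y @ [B, U] @ z))
      (nano q (x @ [P, P] @ y @ z))"
    using homotopic_delete_pair[of "x @ [P]" U B "[P] @ y" z q tau] d5 q AB by auto
  also have "nanoword_homotopic tau (nano q (x @ [P, P] @ y @ z)) (nano q (x @ y @ z))"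
    by (rule homotopic_delete_letter[OF d6])
  also have "nanoword_homotopic tau (nano q (x @ y @ z)) (nano p (x @ y @ z))"
    by (rule homotopic_relabel[OF d']) (rule pq[symmetric], auto)
  finally show ?thesis .
qed

section \<open>Colourings\<close>

text \<open>
  The first component of a state is the memory. The entry of a letter is erased at its second
  occurrence, so that a deleted letter leaves no trace in the memory.
\<close>

fun pass :: "('a \<Rightarrow> 'x \<Rightarrow> 'x) \<Rightarrow> ('a \<Rightarrow> 'x \<Rightarrow> 'x \<Rightarrow> 'x) \<Rightarrow> ('l \<Rightarrow> 'a) \<Rightarrow>
    ('l \<Rightarrow> 'x option) \<times> 'x \<Rightarrow> 'l \<Rightarrow> ('l \<Rightarrow> 'x option) \<times> 'x" where
  "pass f s p (r, x) A = (case r A of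
     None \<Rightarrow> (r(A := Some x), f (p A) x)
   | Some y \<Rightarrow> (r(A := None), s (p A) y x))"

definition final_colour ::
  "('a \<Rightarrow> 'x \<Rightarrow> 'x) \<Rightarrow> ('a \<Rightarrow> 'x \<Rightarrow> 'x \<Rightarrow> 'x) \<Rightarrow> ('l, 'a) etale \<Rightarrow> 'x \<Rightarrow> 'x" where
  "final_colour f s W x = snd (foldl (pass f s (proj W)) (\<lambda>_. None, x) (letters W))"

lemma override_on_upd:
  "A \<notin> S \<Longrightarrow> override_on (g(A := v)) h S = (override_on g h S)(A := v)"
  by (auto simp: override_on_def fun_eq_iff)

text \<open>
  The equations are what the three moves ask for: the first for \<open>A A\<close>; the next two for the first
  and the second passage through a cancelling pair; the last two for the strands of the third move
  on which a first and a second passage, or two second passages, are interchanged. The strand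
  with two first passages poses no condition, since both carry the same label.
\<close>

locale alpha_kei =
  fixes tau :: "'a \<Rightarrow> 'a" and f :: "'a \<Rightarrow> 'x \<Rightarrow> 'x" and s :: "'a \<Rightarrow> 'x \<Rightarrow> 'x \<Rightarrow> 'x"
  assumes kink: "s c x (f c x) = x"
    and bigon_first: "f c (f (tau c) x) = x"
    and bigon_second: "s (tau c) x (s c (f (tau c) x) y) = y"
    and triangle_first: "s c (f c x) (f c y) = f c (s c x y)"
    and triangle_second: "s c (s c x y) (s c (f c x) z) = s c x (s c y z)"
begin

abbreviation run :: "('l \<Rightarrow> 'a) \<Rightarrow> ('l \<Rightarrow> 'x option) \<times> 'x \<Rightarrow> 'l list \<Rightarrow> ('l \<Rightarrow> 'x option) \<times> 'x" where
  "run p \<equiv> foldl (pass f s p)"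

text \<open>
  A segment of a word neither reads nor changes the memory of letters that do not occur in it. This
  lets the segments between the letters of a move be treated as black boxes: the move may
  change the memory of its own letters, but not the effect of the segments.
\<close>

lemma run_local:
  "\<exists>r' x'. \<forall>\<rho>. (\<forall>A\<in>set w. \<rho> A = r A) \<longrightarrow> run p (\<rho>, x) w = (override_on \<rho> r' (set w), x')"
proof (induction w arbitrary: r x)
  case Nil
  show ?case by simp
next
  case (Cons B w)
  obtain r1 x1 where B: "pass f s p (r, x) B = (r1, x1)" by fastforce
  from Cons[of r1 x1] obtain r' x' where
    r': "(\<forall>A\<in>set w. \<rho> A = r1 A) \<Longrightarrow> run p (\<rho>, x1) w = (override_on \<rho> r' (set w), x')" for \<rho>
    by blast
  have "run p (\<rho>, x) (B # w) = (override_on \<rho> (if B \<in> set w then r' else r'(B := r1 B)) (set (B # w)), x')"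
    if "\<forall>A\<in>set (B # w). \<rho> A = r A" for \<rho>
  proof -
    have "pass f s p (\<rho>, x) B = (\<rho>(B := r1 B), x1)"
      using B that by (auto split: option.splits)
    moreover have "\<forall>A\<in>set w. (\<rho>(B := r1 B)) A = r1 A"
      using B that by (auto split: option.splits)
    ultimately show ?thesis
      using r'[of "\<rho>(B := r1 B)"] by (auto simp: override_on_def fun_eq_iff)
  qed
  then show ?case by blast
qed

lemma run_rename:
  assumes "inj_on g S" "set w \<subseteq> S" "\<And>A. A \<in> S \<Longrightarrow> q (g A) = p A" "\<And>A. A \<in> S \<Longrightarrow> r' (g A) = r A"
  shows "snd (run q (r', x) (map g w)) = snd (run p (r, x) w)"
  using assms(2,4)
proof (induction w arbitrary: r r' x)
  case (Cons B w)
  obtain r1 x1 where B: "pass f s p (r, x) B = (r1, x1)" by fastforce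
  obtain r1' x1' where B': "pass f s q (r', x) (g B) = (r1', x1')" by fastforce
  have g: "g A = g B \<longleftrightarrow> A = B" if "A \<in> S" for A
    using that Cons.prems(1) assms(1) by (auto dest: inj_onD)
  have x1: "x1' = x1" and "r1' (g A) = r1 A" if "A \<in> S" for A
    using B B' Cons.prems assms(3)[of B] g that by (auto split: option.splits)
  then have "snd (run q (r1', x1) (map g w)) = snd (run p (r1, x1) w)"
    using Cons.IH[of r1' r1 x1] Cons.prems(1) by auto
  then show ?case using B B' x1 Cons.prems(1) by auto
qed simp

lemma final_colour_step:
  assumes "nanoword_step tau W V"
  shows "final_colour f s W x0 = final_colour f s V x0"
  using assms
proof cases
  case iso
  then obtain g where g: "bij_betw g (alphabet W) (alphabet V)"
    "\<forall>A\<in>alphabet W. proj V (g A) = proj W A" "map g (letters W) = letters V"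
    by (auto simp: isomorphic_def)
  have "snd (run (proj V) (\<lambda>_. None, x0) (map g (letters W))) =
      snd (run (proj W) (\<lambda>_. None, x0) (letters W))"
    using g iso(1) by (intro run_rename[of g "alphabet W"])
      (auto simp: bij_betw_def nanoword_def etale_word_def)
  then show ?thesis by (simp add: final_colour_def g(3))
next
  case (move1 \<A> p x A y)
  obtain r1 x1 where "\<forall>\<rho>. (\<forall>A\<in>set x. \<rho> A = None) \<longrightarrow>
      run p (\<rho>, x0) x = (override_on \<rho> r1 (set x), x1)"
    using run_local[of x "\<lambda>_. None" p x0] by blast
  then have x: "run p (\<lambda>_. None, x0) x = (override_on (\<lambda>_. None) r1 (set x), x1)"
    by simp
  have "A \<notin> set x" using move1(4) by auto
  then show ?thesis using move1(1,2) x
    by (simp add: final_colour_def kink fun_upd_idem)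
next
  case (move2 \<A> p x A B y z)
  have fresh: "A \<notin> set x" "B \<notin> set x" "A \<notin> set y" "B \<notin> set y" using move2(5) by auto
  obtain r1 x1 where "\<forall>\<rho>. (\<forall>A\<in>set x. \<rho> A = None) \<longrightarrow>
      run p (\<rho>, x0) x = (override_on \<rho> r1 (set x), x1)"
    using run_local[of x "\<lambda>_. None" p x0] by blast
  then have x: "run p (\<lambda>_. None, x0) x = (override_on (\<lambda>_. None) r1 (set x), x1)"
    by simp
  let ?r1 = "override_on (\<lambda>_. None) r1 (set x)"
  obtain r2 x2 where y: "\<forall>\<rho>. (\<forall>A\<in>set y. \<rho> A = ?r1 A) \<longrightarrow>
      run p (\<rho>, x1) y = (override_on \<rho> r2 (set y), x2)"
    using run_local[of y "?r1" p "x1"] by blast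
  let ?r2 = "override_on ?r1 r2 (set y)"
  have 1: "run p (\<lambda>_. None, x0) (x @ y) = (?r2, x2)"
    using x y by simp
  have y12: "run p (?r1(A := u, B := v), x1) y = (?r2(A := u, B := v), x2)" for u v
  proof -
    have "\<forall>D\<in>set y. (?r1(A := u, B := v)) D = ?r1 D"
      using fresh by auto
    from y[THEN spec[of _ "?r1(A := u, B := v)"], THEN mp, OF this] show ?thesis using fresh by (simp add: override_on_upd)
  qed
  have none: "?r1 A = None" "?r1 B = None" "?r2 A = None" "?r2 B = None"
    using fresh by auto
  have 2: "run p (\<lambda>_. None, x0) (x @ [A, B] @ y @ [B, A]) = (?r2, x2)"
    using x y12 none move2(4,6) by (simp add: bigon_first bigon_second fun_upd_idem fun_upd_twist)
  have "run p (\<lambda>_. None, x0) (x @ [A, B] @ y @ [B, A] @ z) = run p (\<lambda>_. None, x0) (x @ y @ z)"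
    using 1 2 by simp
  then show ?thesis by (simp only: final_colour_def move2(1,2) etale.simps)
next
  case (move3 \<A> p x A B y C z t)
  have fresh: "A \<notin> set x" "B \<notin> set x" "C \<notin> set x" "A \<notin> set y" "B \<notin> set y" "C \<notin> set y"
    "A \<notin> set z" "B \<notin> set z" "C \<notin> set z" "A \<noteq> B" "A \<noteq> C" "B \<noteq> C"
    using move3(4,5) by auto
  obtain a where a: "p A = a" "p B = a" "p C = a" using move3(6,7) by auto
  obtain r1 x1 where "\<forall>\<rho>. (\<forall>A\<in>set x. \<rho> A = None) \<longrightarrow>
      run p (\<rho>, x0) x = (override_on \<rho> r1 (set x), x1)"
    using run_local[of x "\<lambda>_. None" p x0] by blast
  then have x: "run p (\<lambda>_. None, x0) x = (override_on (\<lambda>_. None) r1 (set x), x1)"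
    by simp
  let ?r1 = "override_on (\<lambda>_. None) r1 (set x)"
  obtain r2 x2 where y: "\<forall>\<rho>. (\<forall>A\<in>set y. \<rho> A = ?r1 A) \<longrightarrow>
      run p (\<rho>, f a (f a x1)) y = (override_on \<rho> r2 (set y), x2)"
    using run_local[of y "?r1" p "f a (f a x1)"] by blast
  let ?r2 = "override_on ?r1 r2 (set y)"
  obtain r3 x3 where z: "\<forall>\<rho>. (\<forall>A\<in>set z. \<rho> A = ?r2 A) \<longrightarrow>
      run p (\<rho>, f a (s a x1 x2)) z = (override_on \<rho> r3 (set z), x3)"
    using run_local[of z "?r2" p "f a (s a x1 x2)"] by blast
  let ?r3 = "override_on ?r2 r3 (set z)"
  have y12: "run p (?r1(A := u, B := v), f a (f a x1)) y = (?r2(A := u, B := v), x2)" for u v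
  proof -
    have "\<forall>D\<in>set y. (?r1(A := u, B := v)) D = ?r1 D"
      using fresh by auto
    from y[THEN spec[of _ "?r1(A := u, B := v)"], THEN mp, OF this] show ?thesis using fresh by (simp add: override_on_upd)
  qed
  have z12: "run p (?r2(B := v, C := w), f a (s a x1 x2)) z =
      (?r3(B := v, C := w), x3)" for v w
  proof -
    have "\<forall>D\<in>set z. (?r2(B := v, C := w)) D = ?r2 D"
      using fresh by auto
    from z[THEN spec[of _ "?r2(B := v, C := w)"], THEN mp, OF this] show ?thesis using fresh by (simp add: override_on_upd)
  qed
  have none: "?r1 A = None" "?r1 B = None" "?r2 A = None" "?r2 B = None" "?r2 C = None"
    using fresh by auto
  let ?s = "(\<lambda>_. None, x0)"
  \<comment> \<open>\<open>triangle_first\<close> makes the colours agree when the segment \<open>z\<close> is entered.\<close>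
  have L1: "run p ?s (x @ [A, B] @ y @ [A, C]) =
      (?r2(B := Some (f a x1), C := Some (s a x1 x2)), f a (s a x1 x2))"
    using x y12 none a fresh by (simp add: fun_upd_twist)
  have R1: "run p ?s (x @ [B, A] @ y @ [C, A]) =
      (?r2(B := Some x1, C := Some x2), f a (s a x1 x2))"
    using x y12 none a fresh by (simp add: fun_upd_twist[of _ B] triangle_first)
  have L2: "run p ?s ((x @ [A, B] @ y @ [A, C]) @ z @ [B, C]) =
      (?r3, s a (s a x1 x2) (s a (f a x1) x3))"
    unfolding foldl_append[of _ _ "x @ [A, B] @ y @ [A, C]"] L1 using z12 a fresh
    by (simp add: fun_upd_twist fun_upd_idem)
  have R2: "run p ?s ((x @ [B, A] @ y @ [C, A]) @ z @ [C, B]) =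
      (?r3, s a x1 (s a x2 x3))"
    unfolding foldl_append[of _ _ "x @ [B, A] @ y @ [C, A]"] R1 using z12 a fresh
    by (simp add: fun_upd_twist fun_upd_idem)
  have "run p ?s (((x @ [A, B] @ y @ [A, C]) @ z @ [B, C]) @ t) =
      run p ?s (((x @ [B, A] @ y @ [C, A]) @ z @ [C, B]) @ t)"
    unfolding foldl_append[of _ _ _ t] L2 R2 triangle_second ..
  then show ?thesis by (simp only: final_colour_def move3(1,2) etale.simps append.simps append_assoc)
qed

theorem final_colour_homotopic:
  assumes "nanoword_homotopic tau W V"
  shows "final_colour f s W x = final_colour f s V x"
proof -
  have "equivclp (nanoword_step tau) W V"
    using assms by (simp add: nanoword_homotopic_def)
  then show ?thesis
    by (induction rule: equivclp_induct) (auto dest: final_colour_step[of _ _ x])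
qed

end


text \<open>
  For a linear second passage \<open>u c * y + v c * x\<close> the first equation forces \<open>v c = 1 - t c * u c\<close>; all
  the others then hold, because the coefficients commute and the weights of \<open>c\<close> and \<open>\<tau>(c)\<close> are
  inverse to each other.
\<close>

lemma alexander_kei:
  fixes t u :: "'a \<Rightarrow> 'x :: field"
  assumes t: "\<And>c. t c * t (tau c) = 1" and u: "\<And>c. u c * u (tau c) = 1"
  shows "alpha_kei tau (\<lambda>c x. t c * x) (\<lambda>c x y. u c * y + (1 - t c * u c) * x)"
proof
  fix c x y z
  show "u (tau c) * (u c * y + (1 - t c * u c) * (t (tau c) * x)) +
      (1 - t (tau c) * u (tau c)) * x = y"
    using t[of c] u[of c] by algebra
  show "t c * (t (tau c) * x) = x" using t[of c] by (simp flip: mult.assoc)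
qed (simp_all add: algebra_simps)

text \<open>The final colour depends linearly on the initial one; this is the factor.\<close>

definition alexander_value :: "('a \<Rightarrow> 'x) \<Rightarrow> ('a \<Rightarrow> 'x) \<Rightarrow> ('l, 'a) etale \<Rightarrow> 'x :: field" where
  "alexander_value t u W =
    final_colour (\<lambda>c x. t c * x) (\<lambda>c x y. u c * y + (1 - t c * u c) * x) W 1"

section \<open>Desingularization of words\<close>

lemma exists_occurrence:
  assumes "1 \<le> i" "i \<le> count_list w A"
  shows "\<exists>k < length w. w ! k = A \<and> count_list (take (k + 1) w) A = i"
  using assms(2)
proof (induction w rule: rev_induct)
  case Nil
  then show ?case using assms(1) by simp
next
  case (snoc B w)
  show ?case
  proof (cases "i \<le> count_list w A")
    case True
    then obtain k where "k < length w" "w ! k = A" "count_list (take (k + 1) w) A = i"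
      using snoc.IH by blast
    then show ?thesis by (intro exI[of _ k]) (simp add: nth_append)
  next
    case False
    then have "B = A" "i = count_list w A + 1"
      using snoc.prems by (auto split: if_splits)
    then show ?thesis by (intro exI[of _ "length w"]) simp
  qed
qed

lemma set_desing_block:
  "set (desing_block A k m) = {(A, i, j) |i j. i < j \<and> (i = k \<and> j \<le> m \<or> 1 \<le> i \<and> j = k)}"
  unfolding desing_block_def by auto

text \<open>
  Desingularizations are therefore of the form \<open>nano\<close>. The letter \<open>A\<^sub>i\<^sub>,\<^sub>j\<close> occurs in the block of the \<open>i\<close>-th occurrence of \<open>A\<close>.
\<close>

lemma set_desing_letters:
  "set (desing_letters w) = {(A, i, j). 1 \<le> i \<and> i < j \<and> j \<le> count_list w A}"
proof -
  have le: "count_list (take n w) A \<le> count_list w A" for n A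
    by (metis append_take_drop_id count_list_append le_add1)
  have pos: "1 \<le> count_list (take (Suc k) w) (w ! k)" if "k < length w" for k
    using that by (simp add: take_Suc_conv_app_nth)
  show ?thesis
  proof (intro equalityI subsetI)
    fix x assume "x \<in> set (desing_letters w)"
    then show "x \<in> {(A, i, j). 1 \<le> i \<and> i < j \<and> j \<le> count_list w A}"
      using le pos unfolding desing_letters_def by (auto simp: set_desing_block)
  next
    fix x assume "x \<in> {(A, i, j). 1 \<le> i \<and> i < j \<and> j \<le> count_list w A}"
    then obtain A i j where x: "x = (A, i, j)" "1 \<le> i" "i < j" "j \<le> count_list w A" by auto
    then obtain k where "k < length w" "w ! k = A" "count_list (take (k + 1) w) A = i"
      using exists_occurrence[of i w A] by auto
    with x show "x \<in> set (desing_letters w)"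
      unfolding desing_letters_def by (force simp: set_desing_block)
  qed
qed

lemma desingularization_word: "desingularization (word w) = nano fst (desing_letters w)"
  by (auto simp: desingularization_def word_def nano_def set_desing_letters fun_eq_iff)

lemma desing_letters_words:
  assumes "a \<noteq> b"
  shows
    "desing_letters [a,a,a,b,b] =
      [(a,1,2), (a,1,3), (a,1,2), (a,2,3), (a,1,3), (a,2,3), (b,1,2), (b,1,2)]"
    "desing_letters [a,a,b,b,a] =
      [(a,1,2), (a,1,3), (a,1,2), (a,2,3), (b,1,2), (b,1,2), (a,1,3), (a,2,3)]"
    "desing_letters [a,b,b,a,a] =
      [(a,1,2), (a,1,3), (b,1,2), (b,1,2), (a,1,2), (a,2,3), (a,1,3), (a,2,3)]"
    "desing_letters [b,b,a,a,a] =
      [(b,1,2), (b,1,2), (a,1,2), (a,1,3), (a,1,2), (a,2,3), (a,1,3), (a,2,3)]"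
    "desing_letters [b,a,a,a,b] =
      [(b,1,2), (a,1,2), (a,1,3), (a,1,2), (a,2,3), (a,1,3), (a,2,3), (b,1,2)]"
    "desing_letters [a,b,a,b,a] =
      [(a,1,2), (a,1,3), (b,1,2), (a,1,2), (a,2,3), (b,1,2), (a,1,3), (a,2,3)]"
    "desing_letters [a,b,a,a,b] =
      [(a,1,2), (a,1,3), (b,1,2), (a,1,2), (a,2,3), (a,1,3), (a,2,3), (b,1,2)]"
    "desing_letters [b,a,a,b,a] =
      [(b,1,2), (a,1,2), (a,1,3), (a,1,2), (a,2,3), (b,1,2), (a,1,3), (a,2,3)]"
    "desing_letters [a,a,b,a,b] =
      [(a,1,2), (a,1,3), (a,1,2), (a,2,3), (b,1,2), (a,1,3), (a,2,3), (b,1,2)]"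
    "desing_letters [b,a,b,a,a] =
      [(b,1,2), (a,1,2), (a,1,3), (b,1,2), (a,1,2), (a,2,3), (a,1,3), (a,2,3)]"
  using assms
  by (simp_all add: desing_letters_def desing_block_def upt_rec numeral_eq_Suc)

lemma word_homotopic_iff:
  "word_homotopic tau v w \<longleftrightarrow>
    nanoword_homotopic tau (nano fst (desing_letters v)) (nano fst (desing_letters w))"
  by (simp add: word_homotopic_def etale_homotopic_def desingularization_word)

lemma contractible_word_iff:
  "contractible_word tau w \<longleftrightarrow> nanoword_homotopic tau (nano fst (desing_letters w)) (nano fst [])"
proof -
  have "desingularization empty_nanoword = nano (\<lambda>_. undefined) []"
    by (auto simp: desingularization_def empty_nanoword_def nano_def desing_letters_def)
  moreover have "nanoword_homotopic tau (nano (\<lambda>_. undefined) []) (nano fst [])"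
    by (rule homotopic_relabel) (simp_all add: doubled_def)
  ultimately show ?thesis
    unfolding contractible_word_def etale_homotopic_def desingularization_word
    by (metis nanoword_homotopic_sym nanoword_homotopic_trans)
qed

text \<open>
  The third move gives \<open>B A C A C B\<close>, in which \<open>A C A C\<close> is a parallel pair since \<open>\<tau>(a) = a\<close>.
\<close>

lemma triangle_contractible:
  fixes p :: "'l \<Rightarrow> 'a"
  assumes inf: "infinite (UNIV :: 'l set)" and inv: "\<And>c. tau (tau c) = c"
    and d: "doubled (x @ [A, B, A, C, B, C] @ y)"
    and a: "p A = a" "p B = a" "p C = a" "tau a = a"
  shows "nanoword_homotopic tau (nano p (x @ [A, B, A, C, B, C] @ y)) (nano p (x @ y))"
proof -
  have d1: "doubled (x @ [B, A] @ [C, A] @ [C, B] @ y)"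
    using d doubled_cong[of "x @ [A, B, A, C, B, C] @ y" "x @ [B, A] @ [C, A] @ [C, B] @ y"] by auto
  have d2: "doubled (x @ [B, B] @ y)"
    using d1 doubled_add_pair[of "x @ [B, A] @ [C, A] @ [C, B] @ y" "x @ [B, B] @ y" A C] by auto
  have "nanoword_homotopic tau (nano p (x @ [A, B, A, C, B, C] @ y))
      (nano p (x @ [B, A] @ [C, A] @ [C, B] @ y))"
    using homotopic_triangle[of x A B "[]" C "[]" y p tau] d a by simp
  also have "nanoword_homotopic tau (nano p (x @ [B, A] @ [C, A] @ [C, B] @ y)) (nano p (x @ [B, B] @ y))"
    using homotopic_delete_parallel_pair[OF inf inv, of "x @ [B]" A C "[]" "[B] @ y" p] d1 a by simp
  also have "nanoword_homotopic tau (nano p (x @ [B, B] @ y)) (nano p (x @ y))"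
    by (rule homotopic_delete_letter[OF d2])
  finally show ?thesis .
qed

section \<open>Weights on the labels\<close>

text \<open>
  A weight is inverted by \<open>\<tau>\<close>. Its values at two labels are constrained by each other, or by
  themselves, only where \<open>\<tau>\<close> fixes or exchanges these labels.
\<close>

lemma obtain_weight:
  fixes \<alpha> \<beta> :: "'x :: field" and a b :: 'a
  assumes inv: "\<forall>c. tau (tau c) = c" and "a \<noteq> b" "\<alpha> \<noteq> 0" "\<beta> \<noteq> 0"
    "tau a = a \<Longrightarrow> \<alpha> * \<alpha> = 1" "tau b = b \<Longrightarrow> \<beta> * \<beta> = 1" "tau a = b \<Longrightarrow> \<alpha> * \<beta> = 1"
  obtains t where "t a = \<alpha>" "t b = \<beta>" "\<forall>c. t c * t (tau c) = 1"
proof -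
  define t where "t c = (if c = a then \<alpha> else if c = b then \<beta> else
    if c = tau a then 1 / \<alpha> else if c = tau b then 1 / \<beta> else 1)" for c
  have tau_eq: "tau c = d \<longleftrightarrow> c = tau d" for c d using inv by metis
  have "t c * t (tau c) = 1" for c
    using assms(2-) unfolding t_def by (auto simp: tau_eq inv[rule_format] mult.commute)
  then show ?thesis using that[of t] \<open>a \<noteq> b\<close> by (simp add: t_def)
qed

context
  fixes tau :: "'a \<Rightarrow> 'a" and t u :: "'a \<Rightarrow> 'x :: field"
  assumes t: "\<forall>c. t c * t (tau c) = 1" and u: "\<forall>c. u c * u (tau c) = 1"
begin

lemma alexander_value_homotopic:
  "nanoword_homotopic tau W V \<Longrightarrow> alexander_value t u W = alexander_value t u V"
  unfolding alexander_value_def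
  by (rule alpha_kei.final_colour_homotopic[OF alexander_kei]) (use t u in simp_all)

lemma not_word_homotopic:
  "alexander_value t u (nano fst (desing_letters v)) \<noteq> alexander_value t u (nano fst (desing_letters w))
    \<Longrightarrow> \<not> word_homotopic tau v w"
  using alexander_value_homotopic unfolding word_homotopic_iff by blast

lemma not_contractible_word:
  assumes "alexander_value t u (nano fst (desing_letters w)) \<noteq> 1"
  shows "\<not> contractible_word tau w"
proof -
  have "alexander_value t u (nano fst []) = 1"
    by (simp add: alexander_value_def final_colour_def nano_def)
  then show ?thesis
    using assms alexander_value_homotopic unfolding contractible_word_iff by metis
qed

end

section \<open>Words of three letters a and two letters b\<close>

theorem theorem6p7:
  fixes tau :: "'a \<Rightarrow> 'a" and a b :: 'a
  assumes involution: "\<forall>c. tau (tau c) = c"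
    and distinct: "a \<noteq> b"
  shows
    "(\<forall>v \<in> {[a,a,a,b,b], [a,a,b,b,a], [a,b,b,a,a], [b,b,a,a,a]}.
      \<forall>w \<in> {[a,a,a,b,b], [a,a,b,b,a], [a,b,b,a,a], [b,b,a,a,a]}. word_homotopic tau v w) \<and>
    (\<forall>w \<in> {[a,a,a,b,b], [a,a,b,b,a], [a,b,b,a,a], [b,b,a,a,a]}.
      contractible_word tau w \<longleftrightarrow> tau a = a) \<and>
    (contractible_word tau [b,a,a,a,b] \<longleftrightarrow> tau a = a) \<and>
    (contractible_word tau [a,b,a,b,a] \<longleftrightarrow> tau a = b) \<and>
    (\<forall>w \<in> {[a,b,a,a,b], [b,a,a,b,a], [a,a,b,a,b], [b,a,b,a,a]}.
      \<not> contractible_word tau w) \<and>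
    (\<forall>v \<in> {[b,a,a,a,b], [a,b,a,b,a], [a,b,a,a,b], [b,a,a,b,a], [a,a,b,a,b], [b,a,b,a,a]}.
      \<forall>w \<in> {[a,a,a,b,b], [a,a,b,b,a], [a,b,b,a,a], [b,b,a,a,a]}.
      \<not> contractible_word tau v \<longrightarrow> \<not> word_homotopic tau v w) \<and>
    (\<forall>v \<in> {[b,a,a,a,b], [a,b,a,b,a], [a,b,a,a,b], [b,a,a,b,a], [a,a,b,a,b], [b,a,b,a,a]}.
      \<forall>w \<in> {[b,a,a,a,b], [a,b,a,b,a], [a,b,a,a,b], [b,a,a,b,a], [a,a,b,a,b], [b,a,b,a,a]}.
      \<not> contractible_word tau v \<longrightarrow> \<not> contractible_word tau w \<longrightarrow>
      (word_homotopic tau v w \<longleftrightarrow>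
        v = w \<or>
        (tau a = b \<and> v \<in> {[a,a,b,a,b], [b,a,b,a,a], [b,a,a,a,b]}
                   \<and> w \<in> {[a,a,b,a,b], [b,a,b,a,a], [b,a,a,a,b]})))"
proof -
  have inv: "tau (tau c) = c" for c using involution by simp
  have inf: "infinite (UNIV :: ('a \<times> nat \<times> nat) set)"
    by (simp add: finite_cartesian_product_iff flip: UNIV_Times_UNIV)
  have ba: "b \<noteq> a" using distinct by simp
  \<comment> \<open>The letters of all ten desingularizations: three labelled \<open>a\<close>, one labelled \<open>b\<close>.\<close>
  let ?A = "(a, 1, 2) :: 'a \<times> nat \<times> nat" and ?B = "(a, 1, 3) :: 'a \<times> nat \<times> nat"
    and ?C = "(a, 2, 3) :: 'a \<times> nat \<times> nat" and ?D = "(b, 1, 2) :: 'a \<times> nat \<times> nat"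
  let ?N = "\<lambda>w. nano fst (desing_letters w)"
  note desing = desing_letters_words[OF distinct]
  let ?G = "{[a,a,a,b,b], [a,a,b,b,a], [a,b,b,a,a], [b,b,a,a,a]}"
  let ?T = "nano fst [?A, ?B, ?A, ?C, ?B, ?C]"
  have T: "nanoword_homotopic tau (?N w) ?T" if "w \<in> ?G" for w
    using that
      homotopic_delete_letter[of "[?A, ?B, ?A, ?C, ?B, ?C]" ?D "[]" tau fst]
      homotopic_delete_letter[of "[?A, ?B, ?A, ?C]" ?D "[?B, ?C]" tau fst]
      homotopic_delete_letter[of "[?A, ?B]" ?D "[?A, ?C, ?B, ?C]" tau fst]
      homotopic_delete_letter[of "[]" ?D "[?A, ?B, ?A, ?C, ?B, ?C]" tau fst] distinct ba
    by (elim insertE) (simp_all add: desing doubled_iff_set)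
  have G: "word_homotopic tau v w" if "v \<in> ?G" "w \<in> ?G" for v w
    using T[OF that(1)] T[OF that(2)] unfolding word_homotopic_iff
    by (blast intro: nanoword_homotopic_trans nanoword_homotopic_sym)
  have refl: "word_homotopic tau w w" if "doubled (desing_letters w)" for w
    using that unfolding word_homotopic_iff by (simp add: homotopic_relabel)
  have dbl: "doubled (desing_letters [b,a,a,a,b])" "doubled (desing_letters [a,b,a,b,a])"
    "doubled (desing_letters [a,b,a,a,b])" "doubled (desing_letters [b,a,a,b,a])"
    "doubled (desing_letters [a,a,b,a,b])" "doubled (desing_letters [b,a,b,a,a])"
    using distinct ba by (simp_all add: desing doubled_iff_set)
  define val where "val t u w = alexander_value t u (?N w)" for t u :: "'a \<Rightarrow> rat" and w
  have not_homotopic: "val t u v \<noteq> val t u w \<Longrightarrow> \<not> word_homotopic tau v w"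
    and not_contractible: "val t u w \<noteq> 1 \<Longrightarrow> \<not> contractible_word tau w"
    if "\<forall>c. t c * t (tau c) = 1" "\<forall>c. u c * u (tau c) = 1" for t u v w
    unfolding val_def using that
    by (auto dest: not_word_homotopic[rotated 2] not_contractible_word[rotated 2])
  note compute = val_def desing alexander_value_def final_colour_def nano_def distinct ba
  consider "tau a = a" | "tau a = b" | "tau a \<noteq> a" "tau a \<noteq> b" by blast
  then show ?thesis
  proof cases
    case 1
    have C: "contractible_word tau w" if "w \<in> ?G" for w
    proof -
      have "nanoword_homotopic tau ?T (nano fst [])"
        using triangle_contractible[OF inf inv, of "[]" ?A ?B ?C "[]" fst a] 1
        by (simp add: doubled_iff_set)
      then show ?thesis
        using T[OF that] unfolding contractible_word_iff by (rule nanoword_homotopic_trans[rotated])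
    qed
    have "nanoword_homotopic tau (?N [b,a,a,a,b]) (nano fst [?D, ?D])"
      using triangle_contractible[OF inf inv, of "[?D]" ?A ?B ?C "[?D]" fst a] 1 distinct ba
      by (simp add: desing doubled_iff_set)
    also have "nanoword_homotopic tau (nano fst [?D, ?D]) (nano fst [])"
      using homotopic_delete_letter[of "[]" ?D "[]" tau fst] by (simp add: doubled_iff_set)
    finally have C': "contractible_word tau [b,a,a,a,b]"
      unfolding contractible_word_iff .
    \<comment> \<open>The label \<open>a\<close> admits only the weights \<open>1\<close> and \<open>-1\<close>, and so does \<open>b\<close> if \<open>\<tau>(b) = b\<close>. No single
      choice of these separates the words. The choice below and the one with \<open>t\<close> and \<open>u\<close>
      interchanged do so together.\<close>
    obtain t :: "'a \<Rightarrow> rat" where t: "t a = 1" "t b = -1" "\<forall>c. t c * t (tau c) = 1"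
      by (rule obtain_weight[of tau a b "1 :: rat" "-1"]) (use involution distinct 1 in auto)
    obtain u :: "'a \<Rightarrow> rat" where u: "u a = -1" "u b = 1" "\<forall>c. u c * u (tau c) = 1"
      by (rule obtain_weight[of tau a b "-1 :: rat" 1]) (use involution distinct 1 in auto)
    have tu: "val t u [a,a,a,b,b] = 1" "val t u [a,a,b,b,a] = 1"
      "val t u [a,b,b,a,a] = 1" "val t u [b,b,a,a,a] = 1" "val t u [a,b,a,b,a] = 9"
      "val t u [a,b,a,a,b] = 9" "val t u [b,a,a,b,a] = 1"
      "val t u [a,a,b,a,b] = 1" "val t u [b,a,b,a,a] = -7"
      by (simp_all add: compute t u)
    have ut: "val u t [a,a,a,b,b] = 1" "val u t [a,a,b,b,a] = 1"
      "val u t [a,b,b,a,a] = 1" "val u t [b,b,a,a,a] = 1" "val u t [a,b,a,b,a] = 9"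
      "val u t [a,b,a,a,b] = 1" "val u t [b,a,a,b,a] = 9"
      "val u t [a,a,b,a,b] = -7" "val u t [b,a,b,a,a] = 1"
      by (simp_all add: compute t u)
    show ?thesis
      using 1 distinct ba
      by (simp add: G C C' refl dbl tu ut not_homotopic[OF t(3) u(3)] not_homotopic[OF u(3) t(3)]
          not_contractible[OF t(3) u(3)] not_contractible[OF u(3) t(3)])
  next
    case 2
    then have tb: "tau b = a" using inv by metis
    have D: "contractible_word tau [a,b,a,b,a]"
    proof -
      have "nanoword_homotopic tau (?N [a,b,a,b,a]) (nano fst [?A, ?A, ?C, ?C])"
        using homotopic_delete_pair[of "[?A]" ?B ?D "[?A, ?C]" "[?C]" fst tau] distinct ba tb
        by (simp add: desing doubled_iff_set)
      also have "nanoword_homotopic tau (nano fst [?A, ?A, ?C, ?C]) (nano fst [?C, ?C])"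
        using homotopic_delete_letter[of "[]" ?A "[?C, ?C]" tau fst] by (simp add: doubled_iff_set)
      also have "nanoword_homotopic tau (nano fst [?C, ?C]) (nano fst [])"
        using homotopic_delete_letter[of "[]" ?C "[]" tau fst] by (simp add: doubled_iff_set)
      finally show ?thesis unfolding contractible_word_iff .
    qed
    \<comment> \<open>\<open>aabab\<close> and \<open>babaa\<close> lose a parallel pair formed by the letter of \<open>b\<close> and one of \<open>a\<close>. In \<open>baaab\<close>
      the third move brings a letter of \<open>a\<close> next to the letter of \<open>b\<close> at both ends, in opposite
      orders, so that the second move deletes the two.\<close>
    let ?E = "{[a,a,b,a,b], [b,a,b,a,a], [b,a,a,a,b]}"
    let ?S = "nano fst [?A, ?B, ?A, ?B]"
    have S1: "nanoword_homotopic tau (?N [a,a,b,a,b]) ?S"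
      using homotopic_delete_parallel_pair[OF inf inv, of "[?A, ?B, ?A]" ?C ?D "[?B]" "[]" fst] tb distinct ba
      by (simp add: desing doubled_iff_set)
    have "nanoword_homotopic tau (?N [b,a,b,a,a]) (nano fst [?B, ?C, ?B, ?C])"
      using homotopic_delete_parallel_pair[OF inf inv, of "[]" ?D ?A "[?B]" "[?C, ?B, ?C]" fst] 2 distinct ba
      by (simp add: desing doubled_iff_set)
    also have "nanoword_homotopic tau (nano fst [?B, ?C, ?B, ?C]) ?S"
      by (rule homotopic_rename_crossed_pair) simp_all
    finally have S2: "nanoword_homotopic tau (?N [b,a,b,a,a]) ?S" .
    have "nanoword_homotopic tau (?N [b,a,a,a,b]) (nano fst [?D, ?B, ?A, ?C, ?A, ?C, ?B, ?D])"
      using homotopic_triangle[of "[?D]" ?A ?B "[]" ?C "[]" "[?D]" fst tau] distinct ba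
      by (simp add: desing doubled_iff_set)
    also have "nanoword_homotopic tau \<dots> (nano fst [?A, ?C, ?A, ?C])"
      using homotopic_delete_pair[of "[]" ?D ?B "[?A, ?C, ?A, ?C]" "[]" fst tau] 2 distinct ba
      by (simp add: doubled_iff_set)
    also have "nanoword_homotopic tau \<dots> ?S"
      by (rule homotopic_rename_crossed_pair) simp_all
    finally have S3: "nanoword_homotopic tau (?N [b,a,a,a,b]) ?S" .
    have E: "word_homotopic tau v w" if "v \<in> ?E" "w \<in> ?E" for v w
      using that S1 S2 S3 unfolding word_homotopic_iff
      by (blast intro: nanoword_homotopic_trans nanoword_homotopic_sym)
    \<comment> \<open>The weights at \<open>b\<close> are the inverses of those at \<open>a\<close>. The weights at \<open>a\<close> are small integers for
      which the nanowords that are not homotopic get different values.\<close>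
    obtain t :: "'a \<Rightarrow> rat" where t: "t a = -3" "t b = -1/3" "\<forall>c. t c * t (tau c) = 1"
      by (rule obtain_weight[of tau a b "-3 :: rat" "-1/3"]) (use involution distinct 2 tb in auto)
    obtain u :: "'a \<Rightarrow> rat" where u: "u a = -2" "u b = -1/2" "\<forall>c. u c * u (tau c) = 1"
      by (rule obtain_weight[of tau a b "-2 :: rat" "-1/2"]) (use involution distinct 2 tb in auto)
    have tu: "val t u [a,a,a,b,b] = 361" "val t u [a,a,b,b,a] = 361"
      "val t u [a,b,b,a,a] = 361" "val t u [b,b,a,a,a] = 361" "val t u [b,a,a,a,b] = 61"
      "val t u [a,b,a,b,a] = 1" "val t u [a,b,a,a,b] = 31" "val t u [b,a,a,b,a] = 21"
      "val t u [a,a,b,a,b] = 61" "val t u [b,a,b,a,a] = 61"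
      by (simp_all add: compute t u)
    show ?thesis
      using 2 distinct ba
      by (simp add: G D E refl dbl tu not_homotopic[OF t(3) u(3)] not_contractible[OF t(3) u(3)])
  next
    case 3
    \<comment> \<open>The weights at \<open>a\<close> can be any non-zero numbers; \<open>b\<close> may be fixed by \<open>\<tau>\<close>, and weights \<open>1\<close> and \<open>-1\<close>
      there are admissible in any case.\<close>
    obtain t :: "'a \<Rightarrow> rat" where t: "t a = -2" "t b = 1" "\<forall>c. t c * t (tau c) = 1"
      by (rule obtain_weight[of tau a b "-2 :: rat" 1]) (use involution distinct 3 in auto)
    obtain u :: "'a \<Rightarrow> rat" where u: "u a = 2" "u b = -1" "\<forall>c. u c * u (tau c) = 1"
      by (rule obtain_weight[of tau a b "2 :: rat" "-1"]) (use involution distinct 3 in auto)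
    have tu: "val t u [a,a,a,b,b] = -59" "val t u [a,a,b,b,a] = -59"
      "val t u [a,b,b,a,a] = -59" "val t u [b,b,a,a,a] = -59" "val t u [b,a,a,a,b] = 61"
      "val t u [a,b,a,b,a] = 181" "val t u [a,b,a,a,b] = 67" "val t u [b,a,a,b,a] = 157"
      "val t u [a,a,b,a,b] = 7" "val t u [b,a,b,a,a] = -23"
      by (simp_all add: compute t u)
    show ?thesis
      using 3 by (simp add: G refl dbl not_homotopic[OF t(3) u(3)] not_contractible[OF t(3) u(3)] tu distinct ba)
  qed
qed

end
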